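(* The class of all finite abelian groups, together with pure embeddings, is a Fraïssé class (of length $\omega$). In particular, there exists an abelian group $\mathbb{F}_0$, unique up to isomorphism, such that (i) $\mathbb{F}_0$ is pure-injective for the class of finite abelian groups, and (ii) $\mathbb{F}_0$ is the union of an increasing sequence of countably many finite pure subgroups. This group can be represented as $$\mathbb{F}_0 = \bigoplus_{j \in \mathbb N}\ \bigoplus_{p \in \mathbb P}\ \bigoplus_{n \in \mathbb N}\mathbb{Z}(p^n).$$
   Context: All groups are abelian. $\mathbb P$ is the set of all primes; for $p\in\mathbb P$ and $n\in\mathbb N$, $\mathbb{Z}(p^n)$ is the cyclic group of order $p^n$. A subgroup $A\leq B$ is pure if for every $a\in A$ and every integer $k\geq 1$, if $a=k\cdot b$ for some $b\in B$, then $a=k\cdot a'$ for some $a'\in A$. A pure embedding is an injective homomorphism whose image is a pure subgroup of the codomain. A class $\mathcal K$ of groups with pure embeddings is a Fraïssé class of length $\omega$ if: (1) (Joint Embedding Property) any $a,b\in\mathcal K$ both purely embed into some $c\in\mathcal K$; (2) (Amalgamation Property) for any pure embeddings $f:a\to b$, $g:a\to c$ with $a,b,c\in\mathcal K$ there are $d\in\mathcal K$ and pure embeddings $f':b\to d$, $g':c\to d$ with $f'\circ f=g'\circ g$; (3) $\mathcal K$ is closed under pure subgroups. (For length $\omega$ the further requirement of closure under unions of chains of length less than the given length is vacuous.) A group $\mathbb A$ is pure-injective for a class $\mathcal K$ of groups if for all $B,C\in\mathcal K$ with $B$ a pure subgroup of $C$, every pure embedding $f:B\to\mathbb A$ extends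 to a pure embedding $\overline f:C\to\mathbb A$. (This differs from the usual algebraic meaning of "pure-injective".) *)

theory Defs
  imports "HOL-Algebra.Product_Groups" "HOL-Computational_Algebra.Primes"
begin

text \<open>Groups are written multiplicatively, so the multiple of an element \<open>b\<close> by \<open>k\<close> is
  \<open>b [^] k\<close>. A subgroup \<open>H\<close> of \<open>G\<close> is a group in its own right as \<open>G\<lparr>carrier := H\<rparr>\<close>.\<close>

definition pure_subgroup :: "'a set \<Rightarrow> ('a, 'm) monoid_scheme \<Rightarrow> bool" where
  "pure_subgroup H G \<longleftrightarrow> subgroup H G \<and>
     (\<forall>a\<in>H. \<forall>k::nat. k \<ge> 1 \<longrightarrow>
        (\<exists>b\<in>carrier G. a = b [^]\<^bsub>G\<^esub> k) \<longrightarrow> (\<exists>a'\<in>H. a = a' [^]\<^bsub>G\<^esub> k))"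

definition pure_embedding ::
    "('a, 'm) monoid_scheme \<Rightarrow> ('b, 'n) monoid_scheme \<Rightarrow> ('a \<Rightarrow> 'b) \<Rightarrow> bool" where
  "pure_embedding G H f \<longleftrightarrow> f \<in> mon G H \<and> pure_subgroup (f ` carrier G) H"

text \<open>A class of groups is a set of group structures whose elements are taken from a fixed
  type \<open>'u\<close>. When \<open>'u\<close> is infinite, every finite group has an isomorphic copy over \<open>'u\<close>, so
  \<open>finite_abelian_groups\<close> is then the class of all finite abelian groups up to isomorphism.\<close>

definition finite_abelian_groups :: "'u monoid set" where
  "finite_abelian_groups = {G. comm_group G \<and> finite (carrier G)}"

definition joint_embedding_property :: "'u monoid set \<Rightarrow> bool" where
  "joint_embedding_property K \<longleftrightarrow>
     (\<forall>a\<in>K. \<forall>b\<in>K. \<exists>c\<in>K. (\<exists>f. pure_embedding a c f) \<and> (\<exists>g. pure_embedding b c g))"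

definition amalgamation_property :: "'u monoid set \<Rightarrow> bool" where
  "amalgamation_property K \<longleftrightarrow>
     (\<forall>a\<in>K. \<forall>b\<in>K. \<forall>c\<in>K. \<forall>f g. pure_embedding a b f \<and> pure_embedding a c g \<longrightarrow>
        (\<exists>d\<in>K. \<exists>f' g'. pure_embedding b d f' \<and> pure_embedding c d g' \<and>
           (\<forall>x\<in>carrier a. f' (f x) = g' (g x))))"

definition closed_under_pure_subgroups :: "'u monoid set \<Rightarrow> bool" where
  "closed_under_pure_subgroups K \<longleftrightarrow>
     (\<forall>G\<in>K. \<forall>H. pure_subgroup H G \<longrightarrow> G\<lparr>carrier := H\<rparr> \<in> K)"

text \<open>Length \<open>\<omega>\<close>: closure under unions of chains of smaller length is vacuous and is omitted.\<close>

definition fraisse_class_omega :: "'u monoid set \<Rightarrow> bool" where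
  "fraisse_class_omega K \<longleftrightarrow> (\<forall>G\<in>K. comm_group G) \<and>
     joint_embedding_property K \<and> amalgamation_property K \<and> closed_under_pure_subgroups K"

text \<open>This is not the usual algebraic notion of a pure-injective group: both the given map and
  its extension are pure embeddings.\<close>

definition pure_injective_for :: "('a, 'm) monoid_scheme \<Rightarrow> 'u monoid set \<Rightarrow> bool" where
  "pure_injective_for A K \<longleftrightarrow>
     (\<forall>C\<in>K. \<forall>B. pure_subgroup B C \<and> C\<lparr>carrier := B\<rparr> \<in> K \<longrightarrow>
        (\<forall>f. pure_embedding (C\<lparr>carrier := B\<rparr>) A f \<longrightarrow>
           (\<exists>g. pure_embedding C A g \<and> (\<forall>x\<in>B. g x = f x))))"

definition union_of_finite_pure_chain :: "('a, 'm) monoid_scheme \<Rightarrow> bool" where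
  "union_of_finite_pure_chain G \<longleftrightarrow>
     (\<exists>H :: nat \<Rightarrow> 'a set. mono H \<and> (\<forall>n. finite (H n) \<and> pure_subgroup (H n) G) \<and>
        carrier G = (\<Union>n. H n))"

text \<open>The index \<open>n = 0\<close> contributes only trivial summands.\<close>

definition F0 :: "(nat \<Rightarrow> nat \<Rightarrow> nat \<Rightarrow> int) monoid" where
  "F0 = sum_group UNIV (\<lambda>j::nat. sum_group {p::nat. prime p}
          (\<lambda>p. sum_group UNIV (\<lambda>n::nat. integer_mod_group (p ^ n))))"

end

theory Submission
  imports Defs "HOL-Algebra.Weak_Morphisms" "HOL-Algebra.Multiplicative_Group"
begin

text \<open>If \<open>B\<close> is a proper pure subgroup of a finite abelian group \<open>C\<close>, then an element of maximal
  \<open>p\<close>-power order in \<open>C / B\<close> (\<open>p\<close> a prime dividing the exponent) lifts to some \<open>c\<close> of the same order,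
  and \<open>B \<oplus> \<langle>c\<rangle>\<close> is again pure in \<open>C\<close>. The group \<open>F0\<close> contains, over every finite subset \<open>S\<close>,
  a generator of a summand \<open>Z(p\<^sup>n)\<close> in a coordinate where all elements of \<open>S\<close> vanish. Sending \<open>c\<close> to
  such a generator extends a pure embedding of \<open>B\<close> into \<open>F0\<close> to \<open>B \<oplus> \<langle>c\<rangle>\<close>, and iterating reaches \<open>C\<close>.
  Amalgamation follows by amalgamating inside \<open>F0\<close> and cutting down to a finite pure subgroup,
  and uniqueness is a back-and-forth argument.\<close>

section \<open>Elementary facts on pure subgroups and powers\<close>

lemma pure_subgroupD:
  assumes "pure_subgroup H G"
  shows "subgroup H G"
    and "\<lbrakk>a \<in> H; k \<ge> (1::nat); b \<in> carrier G; a = b [^]\<^bsub>G\<^esub> k\<rbrakk> \<Longrightarrow> \<exists>a'\<in>H. a = a' [^]\<^bsub>G\<^esub> k"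
  using assms unfolding pure_subgroup_def by blast+

lemma pure_subgroup_subset: "pure_subgroup H G \<Longrightarrow> H \<subseteq> carrier G"
  by (simp add: pure_subgroupD(1) subgroup.subset)

lemma pow_carrier_update [simp]:
  "x [^]\<^bsub>G\<lparr>carrier := A\<rparr>\<^esub> (n::nat) = x [^]\<^bsub>G\<^esub> n"
  by (simp add: nat_pow_def)

lemma (in group) pure_subgroup_self: "pure_subgroup (carrier G) G"
  unfolding pure_subgroup_def using subgroup_self by blast

lemma (in group) pure_subgroup_trivial: "pure_subgroup {\<one>} G"
  unfolding pure_subgroup_def using triv_subgroup by auto

lemma (in group) subgroup_pow_closed:
  assumes "subgroup H G" "x \<in> H"
  shows "x [^] (n::nat) \<in> H"
  using assms subgroup_int_pow_closed[of H x "int n"] by (simp add: int_pow_int)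

lemma (in comm_group) comm_group_subgroup:
  assumes "subgroup H G"
  shows "comm_group (G\<lparr>carrier := H\<rparr>)"
proof (rule group.group_comm_groupI)
  show "group (G\<lparr>carrier := H\<rparr>)" using assms subgroup.subgroup_is_group by blast
qed (use subgroup.mem_carrier[OF assms] m_comm in auto)

section \<open>Pure correspondences\<close>

text \<open>The graph of an isomorphism between a pure subgroup of \<open>G\<close> and a pure subgroup of \<open>H\<close>.
  Relations instead of maps make the notion symmetric in \<open>G\<close> and \<open>H\<close>, so that in the
  back-and-forth argument only one direction has to be treated.\<close>

definition pure_correspondence ::
    "('a, 'm) monoid_scheme \<Rightarrow> ('b, 'n) monoid_scheme \<Rightarrow> ('a \<times> 'b) set \<Rightarrow> bool" where
  "pure_correspondence G H R \<longleftrightarrow>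
     pure_subgroup (Domain R) G \<and> pure_subgroup (Range R) H \<and>
     single_valued R \<and> single_valued (R\<inverse>) \<and>
     (\<forall>x y x' y'. (x, y) \<in> R \<longrightarrow> (x', y') \<in> R \<longrightarrow> (x \<otimes>\<^bsub>G\<^esub> x', y \<otimes>\<^bsub>H\<^esub> y') \<in> R)"

lemma pure_correspondence_converse:
  "pure_correspondence G H R \<Longrightarrow> pure_correspondence H G (R\<inverse>)"
  unfolding pure_correspondence_def by auto

lemma pure_correspondence_carrier:
  assumes "pure_correspondence G H R" "(x, y) \<in> R"
  shows "x \<in> carrier G" "y \<in> carrier H"
  using assms pure_subgroup_subset unfolding pure_correspondence_def by blast+

lemma pure_correspondence_mult:
  assumes "pure_correspondence G H R" "(x, y) \<in> R" "(x', y') \<in> R"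
  shows "(x \<otimes>\<^bsub>G\<^esub> x', y \<otimes>\<^bsub>H\<^esub> y') \<in> R"
  using assms unfolding pure_correspondence_def by blast

lemma pure_correspondence_unique:
  assumes "pure_correspondence G H R" "(x, y) \<in> R" "(x', y') \<in> R"
  shows "x = x' \<longleftrightarrow> y = y'"
  using assms unfolding pure_correspondence_def single_valued_def by blast

text \<open>A partner \<open>y\<close> of the identity satisfies \<open>y y = y\<close>, because
  \<open>R\<close> is single-valued, and the only idempotent of a group is its identity.\<close>

lemma pure_correspondence_one:
  assumes "group G" "group H" "pure_correspondence G H R"
  shows "(\<one>\<^bsub>G\<^esub>, \<one>\<^bsub>H\<^esub>) \<in> R"
proof -
  have "\<one>\<^bsub>G\<^esub> \<in> Domain R"
    using assms(3) unfolding pure_correspondence_def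
    by (simp add: pure_subgroupD(1) subgroup.one_closed)
  then obtain y where y: "(\<one>\<^bsub>G\<^esub>, y) \<in> R" by blast
  have "(\<one>\<^bsub>G\<^esub>, y \<otimes>\<^bsub>H\<^esub> y) \<in> R"
    using pure_correspondence_mult[OF assms(3) y y] assms(1) by (simp add: group.is_monoid)
  then have "y \<otimes>\<^bsub>H\<^esub> y = y"
    using pure_correspondence_unique[OF assms(3) _ y] by blast
  then have "y = \<one>\<^bsub>H\<^esub>"
    using assms(2) pure_correspondence_carrier(2)[OF assms(3) y] group.l_cancel_one' by metis
  then show ?thesis using y by simp
qed

lemma pure_correspondence_pow:
  assumes "group G" "group H" "pure_correspondence G H R" "(x, y) \<in> R"
  shows "(x [^]\<^bsub>G\<^esub> (n::nat), y [^]\<^bsub>H\<^esub> n) \<in> R"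
  by (induction n)
    (auto simp: assms pure_correspondence_one[OF assms(1-3)] intro: pure_correspondence_mult)

lemma pure_correspondence_of_embedding:
  assumes G: "group G" and H: "group H" and A: "pure_subgroup A G"
    and f: "pure_embedding (G\<lparr>carrier := A\<rparr>) H f"
  shows "pure_correspondence G H ((\<lambda>x. (x, f x)) ` A)"
proof -
  have inj: "inj_on f A" and img: "pure_subgroup (f ` A) H"
    and mult: "\<And>x y. \<lbrakk>x \<in> A; y \<in> A\<rbrakk> \<Longrightarrow> f (x \<otimes>\<^bsub>G\<^esub> y) = f x \<otimes>\<^bsub>H\<^esub> f y"
    using f unfolding pure_embedding_def mon_def hom_def by auto
  have "Domain ((\<lambda>x. (x, f x)) ` A) = A" "Range ((\<lambda>x. (x, f x)) ` A) = f ` A"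
    by force+
  moreover have "single_valued ((\<lambda>x. (x, f x)) ` A)" "single_valued (((\<lambda>x. (x, f x)) ` A)\<inverse>)"
    using inj by (auto simp: single_valued_def dest: inj_onD)
  moreover have "(x \<otimes>\<^bsub>G\<^esub> x', y \<otimes>\<^bsub>H\<^esub> y') \<in> (\<lambda>x. (x, f x)) ` A"
    if "(x, y) \<in> (\<lambda>x. (x, f x)) ` A" "(x', y') \<in> (\<lambda>x. (x, f x)) ` A" for x y x' y'
    using that mult[of x x'] subgroup.m_closed[OF pure_subgroupD(1)[OF A], of x x']
    by (auto intro: rev_image_eqI)
  ultimately show ?thesis
    unfolding pure_correspondence_def using A img by simp
qed

lemma embedding_of_pure_correspondence:
  assumes R: "pure_correspondence G H R"
  obtains f where "pure_embedding (G\<lparr>carrier := Domain R\<rparr>) H f" "\<And>x y. (x, y) \<in> R \<Longrightarrow> f x = y"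
proof
  define f where "f = (\<lambda>x. THE y. (x, y) \<in> R)"
  show fR: "f x = y" if "(x, y) \<in> R" for x y
    unfolding f_def using that pure_correspondence_unique[OF R] by blast
  then have fin: "(x, f x) \<in> R" if "x \<in> Domain R" for x using that by blast
  have "f ` Domain R = Range R"
    using fR by force
  moreover have "f \<in> hom (G\<lparr>carrier := Domain R\<rparr>) H"
  proof (rule homI)
    fix x y assume "x \<in> carrier (G\<lparr>carrier := Domain R\<rparr>)" "y \<in> carrier (G\<lparr>carrier := Domain R\<rparr>)"
    then have "(x, f x) \<in> R" "(y, f y) \<in> R" using fin by simp_all
    then show "f (x \<otimes>\<^bsub>G\<lparr>carrier := Domain R\<rparr>\<^esub> y) = f x \<otimes>\<^bsub>H\<^esub> f y"
      using fR[OF pure_correspondence_mult[OF R]] by simp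
  next
    fix x assume "x \<in> carrier (G\<lparr>carrier := Domain R\<rparr>)"
    then have "x \<in> Domain R" by simp
    then show "f x \<in> carrier H" by (rule pure_correspondence_carrier(2)[OF R fin])
  qed
  moreover have "inj_on f (Domain R)"
  proof (rule inj_onI)
    fix x y assume "x \<in> Domain R" "y \<in> Domain R" "f x = f y"
    then show "x = y" using fin pure_correspondence_unique[OF R] by blast
  qed
  ultimately show "pure_embedding (G\<lparr>carrier := Domain R\<rparr>) H f"
    using R unfolding pure_embedding_def mon_def pure_correspondence_def by simp
qed

text \<open>Roots travel through \<open>R\<close> in both directions. A \<open>k\<close>-th root of
  \<open>y\<close> in \<open>H\<close> can first be moved into \<open>Range R\<close> by purity of
  the range; its partner in \<open>G\<close> is a root of the partner of \<open>y\<close>; purity of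
  \<open>A\<close> moves that root into \<open>A\<close>, and \<open>R\<close> carries it back to
  \<open>H\<close>.\<close>

lemma pure_image_pure_correspondence:
  assumes G: "group G" and H: "group H" and R: "pure_correspondence G H R"
    and A: "pure_subgroup A G" "A \<subseteq> Domain R"
  shows "pure_subgroup (R `` A) H"
  unfolding pure_subgroup_def
proof (intro conjI ballI allI impI)
  show "subgroup (R `` A) H"
  proof (rule group.subgroupI[OF H])
    show "R `` A \<subseteq> carrier H" using pure_correspondence_carrier[OF R] by blast
    show "R `` A \<noteq> {}"
      using pure_correspondence_one[OF G H R] A(1) pure_subgroupD(1) subgroup.one_closed by fastforce
    show "a \<otimes>\<^bsub>H\<^esub> b \<in> R `` A" if "a \<in> R `` A" "b \<in> R `` A" for a b
      using that pure_correspondence_mult[OF R] subgroup.m_closed[OF pure_subgroupD(1)[OF A(1)]]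
      by blast
    show "inv\<^bsub>H\<^esub> y \<in> R `` A" if "y \<in> R `` A" for y
    proof -
      obtain x where x: "x \<in> A" "(x, y) \<in> R" using \<open>y \<in> R `` A\<close> by blast
      have ix: "inv\<^bsub>G\<^esub> x \<in> A" using x A(1) pure_subgroupD(1) subgroup.m_inv_closed by metis
      then obtain z where z: "(inv\<^bsub>G\<^esub> x, z) \<in> R" using A(2) by blast
      \<comment> \<open>Inverses are not part of the definition of a correspondence. They are
        recovered here: the product of \<open>y\<close> with a partner of the inverse of
        \<open>x\<close> is a partner of the identity.\<close>
      have "(\<one>\<^bsub>G\<^esub>, z \<otimes>\<^bsub>H\<^esub> y) \<in> R"
        using pure_correspondence_mult[OF R z x(2)] G pure_correspondence_carrier[OF R x(2)]
        by (simp add: group.l_inv)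
      then have "z \<otimes>\<^bsub>H\<^esub> y = \<one>\<^bsub>H\<^esub>"
        using pure_correspondence_unique[OF R _ pure_correspondence_one[OF G H R]] by blast
      then have "inv\<^bsub>H\<^esub> y = z"
        using pure_correspondence_carrier[OF R] x z H by (metis group.inv_equality)
      then show ?thesis using z ix by blast
    qed
  qed
next
  fix y k assume y: "y \<in> R `` A" and k: "(1::nat) \<le> k" and "\<exists>b\<in>carrier H. y = b [^]\<^bsub>H\<^esub> k"
  then obtain b where b: "b \<in> carrier H" "y = b [^]\<^bsub>H\<^esub> k" by blast
  have "pure_subgroup (Range R) H" "y \<in> Range R"
    using R y unfolding pure_correspondence_def by blast+
  then obtain z where "z \<in> Range R" "y = z [^]\<^bsub>H\<^esub> k"
    using pure_subgroupD(2)[OF _ _ k b] by blast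
  then obtain w where w: "(w, z) \<in> R" by blast
  obtain x where x: "x \<in> A" "(x, y) \<in> R" using y by blast
  have "x = w [^]\<^bsub>G\<^esub> k"
    using pure_correspondence_unique[OF R x(2) pure_correspondence_pow[OF G H R w, of k]]
      \<open>y = z [^]\<^bsub>H\<^esub> k\<close> by simp
  then obtain x' where x': "x' \<in> A" "x = x' [^]\<^bsub>G\<^esub> k"
    using pure_subgroupD(2)[OF A(1) x(1) k] pure_correspondence_carrier[OF R w] by blast
  then obtain y' where y': "(x', y') \<in> R" using A(2) by blast
  then have "y = y' [^]\<^bsub>H\<^esub> k"
    using pure_correspondence_unique[OF R x(2) pure_correspondence_pow[OF G H R y', of k]] x' by simp
  then show "\<exists>a'\<in>R `` A. y = a' [^]\<^bsub>H\<^esub> k" using y' x' by blast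
qed

text \<open>The inclusion keeps the domain equal to \<open>Domain R\<close>. The range becomes the
  image under \<open>S\<close> of a pure subgroup, which is pure by the preceding lemma.\<close>

lemma pure_correspondence_comp:
  assumes "group G" "group H" "group L"
    and R: "pure_correspondence G H R" and S: "pure_correspondence H L S"
    and sub: "Range R \<subseteq> Domain S"
  shows "pure_correspondence G L (R O S)"
proof -
  have "Domain (R O S) = Domain R" "Range (R O S) = S `` Range R"
    using sub by blast+
  moreover have "pure_subgroup (S `` Range R) L"
    using pure_image_pure_correspondence[OF assms(2,3) S _ sub] R
    unfolding pure_correspondence_def by blast
  moreover have "single_valued (R O S)" "single_valued ((R O S)\<inverse>)"
    using R S unfolding pure_correspondence_def
    by (auto simp: converse_relcomp intro: single_valued_relcomp)
  moreover have "(x \<otimes>\<^bsub>G\<^esub> x', z \<otimes>\<^bsub>L\<^esub> z') \<in> R O S"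
    if "(x, z) \<in> R O S" "(x', z') \<in> R O S" for x z x' z'
    using that pure_correspondence_mult[OF R] pure_correspondence_mult[OF S]
    by (meson relcompE relcompEpair relcompI)
  moreover have "pure_subgroup (Domain R) G"
    using R unfolding pure_correspondence_def by blast
  ultimately show ?thesis
    unfolding pure_correspondence_def by simp
qed

text \<open>The mirror image of the preceding lemma, obtained by passing to converses; it serves
  when the second relation is the partial one.\<close>

lemma pure_correspondence_comp':
  assumes "group G" "group H" "group L"
    and "pure_correspondence G H R" and "pure_correspondence H L S"
    and "Domain S \<subseteq> Range R"
  shows "pure_correspondence G L (R O S)"
proof -
  have "pure_correspondence L G (S\<inverse> O R\<inverse>)"
    using assms by (intro pure_correspondence_comp[of L H G] pure_correspondence_converse) auto
  then show ?thesis
    using pure_correspondence_converse[of L G "S\<inverse> O R\<inverse>"] by (simp add: converse_relcomp)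
qed

section \<open>Adjoining a cyclic pure complement\<close>

text \<open>Says that \<open>e\<close> has order \<open>q\<close> and that its image generates a pure cyclic subgroup of order \<open>q\<close>
  in the quotient of \<open>G\<close> by \<open>S\<close>.\<close>

definition pure_cyclic_over :: "('a, 'm) monoid_scheme \<Rightarrow> 'a set \<Rightarrow> 'a \<Rightarrow> nat \<Rightarrow> bool" where
  "pure_cyclic_over G S e q \<longleftrightarrow>
     e \<in> carrier G \<and> q \<ge> 1 \<and> e [^]\<^bsub>G\<^esub> q = \<one>\<^bsub>G\<^esub> \<and>
     (\<forall>s\<in>S. \<forall>y\<in>carrier G. \<forall>k\<ge>1. \<forall>m. s \<otimes>\<^bsub>G\<^esub> e [^]\<^bsub>G\<^esub> m = y [^]\<^bsub>G\<^esub> k \<longrightarrow> gcd k q dvd m)"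

text \<open>Natural exponents suffice, since \<open>adjoin\<close> is applied to elements
  \<open>e\<close> of finite order \<open>q\<close>: the inverse of the \<open>m\<close>-th power is
  the power with exponent \<open>(q - 1) * m\<close>.\<close>

definition adjoin :: "('a, 'm) monoid_scheme \<Rightarrow> 'a set \<Rightarrow> 'a \<Rightarrow> 'a set" where
  "adjoin G S e = {s \<otimes>\<^bsub>G\<^esub> e [^]\<^bsub>G\<^esub> m | s (m::nat). s \<in> S}"

lemma (in group) pow_eq_mod:
  assumes "e \<in> carrier G" "e [^] (q::nat) = \<one>"
  shows "e [^] m = e [^] (m mod q)"
proof -
  have "e [^] m = (e [^] q) [^] (m div q) \<otimes> e [^] (m mod q)"
    using assms(1) by (simp add: nat_pow_pow nat_pow_mult)
  then show ?thesis using assms by simp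
qed

context comm_group
begin

text \<open>Instance of the divisibility condition with \<open>k = q\<close>, \<open>y\<close> the
  identity and \<open>s\<close> the inverse of \<open>e [^] m\<close>, where
  \<open>gcd q q = q\<close>. So the condition alone already forces the powers of \<open>e\<close>
  to meet \<open>S\<close> trivially.\<close>

lemma pure_cyclic_over_dvd:
  assumes S: "subgroup S G" and e: "pure_cyclic_over G S e q" and "e [^] m \<in> S"
  shows "q dvd m"
proof -
  have "inv (e [^] m) \<in> S" "inv (e [^] m) \<otimes> e [^] m = \<one> [^] q"
    using assms e unfolding pure_cyclic_over_def by (auto intro: subgroup.m_inv_closed)
  then have "gcd q q dvd m"
    using e one_closed unfolding pure_cyclic_over_def by blast
  then show ?thesis by simp
qed

lemma pure_cyclic_over_unique:
  assumes S: "subgroup S G" and e: "pure_cyclic_over G S e q"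
    and s: "s \<in> S" "s' \<in> S" and eq: "s \<otimes> e [^] m = s' \<otimes> e [^] m'"
  shows "s = s'" "m mod q = m' mod q"
proof -
  have ec: "e \<in> carrier G" "e [^] q = \<one>" "q \<ge> 1"
    using e unfolding pure_cyclic_over_def by auto
  have sc: "s \<in> carrier G" "s' \<in> carrier G" using S s subgroup.mem_carrier by metis+
  \<comment> \<open>\<open>?m\<close> represents \<open>m - m'\<close> modulo \<open>q\<close>
    without subtraction of natural numbers. Its power of \<open>e\<close> lies in \<open>S\<close>,
    hence is trivial.\<close>
  let ?m = "m + (q - 1) * m'"
  have 0: "m' + (q - 1) * m' = q * m'" using ec(3) by (cases q) auto
  have "s \<otimes> e [^] ?m = s \<otimes> e [^] m \<otimes> e [^] ((q-1) * m')"
    using ec sc by (simp add: nat_pow_mult[symmetric] m_assoc)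
  also have "\<dots> = s' \<otimes> e [^] (m' + (q-1) * m')"
    unfolding eq using ec sc by (simp add: nat_pow_mult[symmetric] m_assoc)
  also have "\<dots> = s'"
    unfolding 0 using ec sc by (simp add: nat_pow_pow[symmetric])
  finally have 1: "s \<otimes> e [^] ?m = s'" .
  then have "e [^] ?m = inv s \<otimes> s'"
    using ec sc inv_solve_left by (metis nat_pow_closed)
  then have "e [^] ?m \<in> S"
    using S s by (simp add: subgroup.m_closed subgroup.m_inv_closed)
  then have d: "q dvd ?m"
    using pure_cyclic_over_dvd[OF S e] by blast
  then have "e [^] ?m = \<one>" using pow_eq_mod[OF ec(1,2), of ?m] by simp
  then show "s = s'" using 1 sc by simp
  have "(m + (q - 1) * m') + m' = m + q * m'" using 0 by simp
  then have "(m + q * m') mod q = (?m + m') mod q" by metis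
  also have "\<dots> = m' mod q" using d by (metis dvd_imp_mod_0 mod_add_left_eq add_0)
  finally show "m mod q = m' mod q" by simp
qed

text \<open>Suppose \<open>s \<otimes> e [^] m\<close> is a \<open>k\<close>-th power. Then
  \<open>gcd k q\<close> divides \<open>m\<close>, so by Bezout \<open>m\<close> is congruent to a
  multiple of \<open>k\<close> modulo \<open>q\<close>, and \<open>e [^] m\<close> is itself a
  \<open>k\<close>-th power. Dividing by it makes \<open>s\<close> a \<open>k\<close>-th power in
  the group, hence in \<open>S\<close> by purity.\<close>

lemma pure_subgroup_adjoin:
  assumes S: "pure_subgroup S G" and e: "pure_cyclic_over G S e q"
  shows "pure_subgroup (adjoin G S e) G"
proof -
  have ec: "e \<in> carrier G" "e [^] q = \<one>" "q \<ge> 1"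
    using e unfolding pure_cyclic_over_def by auto
  note sub = pure_subgroupD(1)[OF S]
  note sc = subgroup.mem_carrier[OF sub]
  show ?thesis
    unfolding pure_subgroup_def
  proof (intro conjI ballI allI impI)
    show "subgroup (adjoin G S e) G"
    proof (rule subgroupI)
      show "adjoin G S e \<subseteq> carrier G" using ec sc by (auto simp: adjoin_def)
      show "adjoin G S e \<noteq> {}" using subgroup.one_closed[OF sub] by (auto simp: adjoin_def)
      show "a \<otimes> b \<in> adjoin G S e" if ab: "a \<in> adjoin G S e" "b \<in> adjoin G S e" for a b
      proof -
        obtain s m t n where *: "s \<in> S" "t \<in> S" "a = s \<otimes> e [^] (m::nat)" "b = t \<otimes> e [^] (n::nat)"
          using ab unfolding adjoin_def by blast
        have "a \<otimes> b = (s \<otimes> t) \<otimes> e [^] (m + n)"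
          using * ec sc by (simp add: nat_pow_mult[symmetric] m_ac)
        then show ?thesis
          using * subgroup.m_closed[OF sub] unfolding adjoin_def by blast
      qed
      show "inv a \<in> adjoin G S e" if a: "a \<in> adjoin G S e" for a
      proof -
        obtain s m where *: "s \<in> S" "a = s \<otimes> e [^] (m::nat)"
          using a unfolding adjoin_def by blast
        have q: "(q - 1) * m + m = q * m" using ec(3) by (cases q) auto
        have "(inv s \<otimes> e [^] ((q - 1) * m)) \<otimes> (s \<otimes> e [^] m)
            = (inv s \<otimes> s) \<otimes> (e [^] ((q - 1) * m) \<otimes> e [^] m)"
          using *(1) ec sc inv_closed[of s] nat_pow_closed[OF ec(1)]
          by (simp only: m_ac m_closed)
        also have "\<dots> = (inv s \<otimes> s) \<otimes> e [^] ((q - 1) * m + m)"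
          using ec by (simp add: nat_pow_mult)
        also have "\<dots> = \<one>"
          unfolding q using * ec sc by (simp add: nat_pow_pow[symmetric])
        finally have "inv a = inv s \<otimes> e [^] ((q - 1) * m)"
          using * ec sc by (intro inv_equality) auto
        then show ?thesis
          using * subgroup.m_inv_closed[OF sub] unfolding adjoin_def by blast
      qed
    qed
  next
    fix a k assume "a \<in> adjoin G S e" and k: "(1::nat) \<le> k" and "\<exists>b\<in>carrier G. a = b [^] k"
    then obtain s m y where *: "s \<in> S" "a = s \<otimes> e [^] (m::nat)" "y \<in> carrier G" "a = y [^] k"
      unfolding adjoin_def by blast
    have "gcd k q dvd m"
      using e * k unfolding pure_cyclic_over_def by metis
    then obtain r where r: "m = gcd k q * r" by (elim dvdE)
    obtain u v where uv: "k * u = q * v + gcd k q"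
      using bezout_nat[of k q] k by auto
    \<comment> \<open>The \<open>t\<close>-th power of \<open>e\<close> is a \<open>k\<close>-th
      root of \<open>e [^] m\<close>, since \<open>k * t\<close> and \<open>m\<close> agree modulo
      \<open>q\<close>.\<close>
    define t where "t = u * r"
    have "k * t = m + q * (v * r)"
      using arg_cong[OF uv, of "\<lambda>x. x * r"] unfolding t_def r by (simp add: algebra_simps)
    then have t: "e [^] m = e [^] (k * t)"
      using pow_eq_mod[OF ec(1,2), of m] pow_eq_mod[OF ec(1,2), of "k * t"] by simp
    have "(y \<otimes> inv (e [^] t)) [^] k = y [^] k \<otimes> inv (e [^] (k * t))"
      using * ec by (simp add: nat_pow_distrib nat_pow_inv nat_pow_pow mult.commute)
    also have "\<dots> = s"
      using * ec sc t by (metis inv_solve_right' nat_pow_closed)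
    finally obtain s' where s': "s' \<in> S" "s = s' [^] k"
      using pure_subgroupD(2)[OF S *(1) k, of "y \<otimes> inv (e [^] t)"] * ec by auto
    have "(s' \<otimes> e [^] t) [^] k = a"
      using * s' ec sc t by (simp add: nat_pow_distrib nat_pow_pow mult.commute)
    then show "\<exists>a'\<in>adjoin G S e. a = a' [^] k"
      using s' unfolding adjoin_def by blast
  qed
qed

end

text \<open>The new relation sends \<open>c\<close> to \<open>e\<close>. On each side an element
  determines its component in the old subgroup and its exponent modulo \<open>q\<close>; as
  \<open>q\<close> is the same for \<open>c\<close> and \<open>e\<close>, equalities on one side
  match equalities on the other.\<close>

lemma pure_correspondence_adjoin:
  assumes G: "comm_group G" and H: "comm_group H" and R: "pure_correspondence G H R"
    and c: "pure_cyclic_over G (Domain R) c q" and e: "pure_cyclic_over H (Range R) e q"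
  obtains R' where "R \<subseteq> R'" "pure_correspondence G H R'" "Domain R' = adjoin G (Domain R) c"
proof
  interpret G: comm_group G by fact
  interpret H: comm_group H by fact
  define R' where "R' = (\<lambda>((x, y), m::nat). (x \<otimes>\<^bsub>G\<^esub> c [^]\<^bsub>G\<^esub> m, y \<otimes>\<^bsub>H\<^esub> e [^]\<^bsub>H\<^esub> m)) ` (R \<times> UNIV)"
  have R'I: "(x \<otimes>\<^bsub>G\<^esub> c [^]\<^bsub>G\<^esub> m, y \<otimes>\<^bsub>H\<^esub> e [^]\<^bsub>H\<^esub> m) \<in> R'" if "(x, y) \<in> R" for x y and m :: nat
    using that unfolding R'_def by force
  have R'E: "\<exists>x y m. (x, y) \<in> R \<and> u = x \<otimes>\<^bsub>G\<^esub> c [^]\<^bsub>G\<^esub> (m::nat) \<and> v = y \<otimes>\<^bsub>H\<^esub> e [^]\<^bsub>H\<^esub> m"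
    if "(u, v) \<in> R'" for u v
    using that unfolding R'_def by force
  note RC = pure_correspondence_carrier[OF R]
  have cc: "c \<in> carrier G" "c [^]\<^bsub>G\<^esub> q = \<one>\<^bsub>G\<^esub>" and ec: "e \<in> carrier H" "e [^]\<^bsub>H\<^esub> q = \<one>\<^bsub>H\<^esub>"
    using c e unfolding pure_cyclic_over_def by auto
  have pure: "pure_subgroup (Domain R) G" "pure_subgroup (Range R) H"
    using R unfolding pure_correspondence_def by auto
  show dom: "Domain R' = adjoin G (Domain R) c"
    unfolding adjoin_def using R'I R'E by (auto simp: set_eq_iff) blast+
  have ran: "Range R' = adjoin H (Range R) e"
    unfolding adjoin_def using R'I R'E by (auto simp: set_eq_iff) blast+
  show "R \<subseteq> R'"
  proof
    fix z assume "z \<in> R"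
    then show "z \<in> R'" using R'I[of "fst z" "snd z" 0] RC[of "fst z" "snd z"] by simp
  qed
  have unique: "x \<otimes>\<^bsub>G\<^esub> c [^]\<^bsub>G\<^esub> m = x' \<otimes>\<^bsub>G\<^esub> c [^]\<^bsub>G\<^esub> m' \<longleftrightarrow> y \<otimes>\<^bsub>H\<^esub> e [^]\<^bsub>H\<^esub> m = y' \<otimes>\<^bsub>H\<^esub> e [^]\<^bsub>H\<^esub> m'"
    if "(x, y) \<in> R" "(x', y') \<in> R" for x y x' y' and m m' :: nat
  proof
    assume "x \<otimes>\<^bsub>G\<^esub> c [^]\<^bsub>G\<^esub> m = x' \<otimes>\<^bsub>G\<^esub> c [^]\<^bsub>G\<^esub> m'"
    then have "x = x'" "m mod q = m' mod q"
      using G.pure_cyclic_over_unique[OF pure_subgroupD(1)[OF pure(1)] c] that by blast+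
    then show "y \<otimes>\<^bsub>H\<^esub> e [^]\<^bsub>H\<^esub> m = y' \<otimes>\<^bsub>H\<^esub> e [^]\<^bsub>H\<^esub> m'"
      using H.pow_eq_mod[OF ec] pure_correspondence_unique[OF R] that by metis
  next
    assume "y \<otimes>\<^bsub>H\<^esub> e [^]\<^bsub>H\<^esub> m = y' \<otimes>\<^bsub>H\<^esub> e [^]\<^bsub>H\<^esub> m'"
    then have "y = y'" "m mod q = m' mod q"
      using H.pure_cyclic_over_unique[OF pure_subgroupD(1)[OF pure(2)] e] that by blast+
    then show "x \<otimes>\<^bsub>G\<^esub> c [^]\<^bsub>G\<^esub> m = x' \<otimes>\<^bsub>G\<^esub> c [^]\<^bsub>G\<^esub> m'"
      using G.pow_eq_mod[OF cc] pure_correspondence_unique[OF R] that by metis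
  qed
  have "(u \<otimes>\<^bsub>G\<^esub> u', v \<otimes>\<^bsub>H\<^esub> v') \<in> R'" if uv: "(u, v) \<in> R'" "(u', v') \<in> R'" for u v u' v'
  proof -
    obtain x y m where 1: "(x, y) \<in> R" "u = x \<otimes>\<^bsub>G\<^esub> c [^]\<^bsub>G\<^esub> (m::nat)" "v = y \<otimes>\<^bsub>H\<^esub> e [^]\<^bsub>H\<^esub> m"
      using R'E uv(1) by blast
    obtain x' y' n where 2: "(x', y') \<in> R" "u' = x' \<otimes>\<^bsub>G\<^esub> c [^]\<^bsub>G\<^esub> (n::nat)" "v' = y' \<otimes>\<^bsub>H\<^esub> e [^]\<^bsub>H\<^esub> n"
      using R'E uv(2) by blast
    have "u \<otimes>\<^bsub>G\<^esub> u' = (x \<otimes>\<^bsub>G\<^esub> x') \<otimes>\<^bsub>G\<^esub> c [^]\<^bsub>G\<^esub> (m + n)"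
      using 1 2 cc RC by (simp add: G.nat_pow_mult[symmetric] G.m_ac)
    moreover have "v \<otimes>\<^bsub>H\<^esub> v' = (y \<otimes>\<^bsub>H\<^esub> y') \<otimes>\<^bsub>H\<^esub> e [^]\<^bsub>H\<^esub> (m + n)"
      using 1 2 ec RC by (simp add: H.nat_pow_mult[symmetric] H.m_ac)
    ultimately show ?thesis
      using R'I[OF pure_correspondence_mult[OF R 1(1) 2(1)]] by simp
  qed
  moreover have single: "u = u' \<longleftrightarrow> v = v'" if uv: "(u, v) \<in> R'" "(u', v') \<in> R'" for u v u' v'
    using R'E[OF uv(1)] R'E[OF uv(2)] unique by (elim exE conjE) simp
  moreover have "single_valued R'" "single_valued (R'\<inverse>)"
    unfolding single_valued_def converse_iff using single by blast+
  ultimately show "pure_correspondence G H R'"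
    unfolding pure_correspondence_def dom ran
    using G.pure_subgroup_adjoin[OF pure(1) c] H.pure_subgroup_adjoin[OF pure(2) e] by blast
qed

text \<open>Let \<open>N\<close> be the exponent of \<open>G / S\<close>, \<open>p\<close> a prime
  divisor and \<open>q = p ^ n\<close> the full power of \<open>p\<close> in \<open>N\<close>. Some
  element has order \<open>q\<close> modulo \<open>S\<close>, and purity of \<open>S\<close>
  corrects it to an element of order \<open>q\<close> in \<open>G\<close>. Its image is pure in the
  quotient because \<open>q\<close> is the largest order of a \<open>p\<close>-element
  there.\<close>

lemma (in comm_group) exists_pure_cyclic_over:
  assumes fin: "finite (carrier G)" and S: "pure_subgroup S G" and ne: "S \<noteq> carrier G"
  obtains c p n where "prime p" "pure_cyclic_over G S c (p ^ n)" "c \<notin> S"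
proof -
  note sub = pure_subgroupD(1)[OF S]
  note sc = subgroup.mem_carrier[OF sub]
  define P where "P N \<longleftrightarrow> N \<ge> 1 \<and> (\<forall>x\<in>carrier G. x [^] (N::nat) \<in> S)" for N
  have "P (order G)"
    unfolding P_def using fin subgroup.one_closed[OF sub]
    by (auto simp: pow_order_eq_1 order_gt_0_iff_finite Suc_le_eq)
  define N where "N = (LEAST N. P N)"
  have N: "P N" unfolding N_def using \<open>P (order G)\<close> by (rule LeastI)
  have least: "\<not> P M" if "M < N" for M using that unfolding N_def by (rule not_less_Least)
  have "N \<noteq> 1"
  proof
    assume "N = 1"
    then have "carrier G \<subseteq> S" using N unfolding P_def by auto
    then show False using ne sc by blast
  qed
  then obtain p where p: "prime p" "p dvd N" using prime_factor_nat by blast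
  define n where "n = multiplicity p N"
  have "N \<noteq> 0" using N unfolding P_def by simp
  then obtain u where u: "N = p ^ n * u" "\<not> p dvd u"
    using p multiplicity_decompose'[of N p] unfolding n_def by (metis not_prime_unit)
  have n: "n \<ge> 1"
    using p \<open>N \<noteq> 0\<close> prime_multiplicity_gt_zero_iff[of p N] unfolding n_def by simp
  define q where "q = p ^ n"
  have q: "q \<ge> 1" unfolding q_def using p(1) by (simp add: Suc_le_eq prime_gt_0_nat)
  have pq: "q = p ^ (n - 1) * p" unfolding q_def using n by (cases n) auto
  \<comment> \<open>This number is \<open>N / p\<close>, so minimality of \<open>N\<close> yields an
    \<open>x\<close> whose order modulo \<open>S\<close> still contains the full factor
    \<open>p ^ n\<close>.\<close>
  have "\<not> P (p ^ (n - 1) * u)"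
  proof (rule least)
    have "u > 0" using u \<open>N \<noteq> 0\<close> by (cases u) auto
    then show "p ^ (n - 1) * u < N"
      using p(1) u(1) n prime_gt_1_nat by (simp add: power_strict_increasing)
  qed
  moreover have "p ^ (n - 1) * u \<ge> 1"
    using p(1) u(1) \<open>N \<noteq> 0\<close> by (cases u) (auto simp: prime_gt_0_nat Suc_le_eq)
  ultimately obtain x where x: "x \<in> carrier G" "x [^] (p ^ (n - 1) * u) \<notin> S"
    unfolding P_def by blast
  \<comment> \<open>Raising to the power \<open>u\<close> removes the part of the order prime to
    \<open>p\<close>, so \<open>c0\<close> has order exactly \<open>q\<close> modulo
    \<open>S\<close>.\<close>
  define c0 where "c0 = x [^] u"
  have c0: "c0 \<in> carrier G" "c0 [^] (p ^ (n - 1)) \<notin> S" "c0 [^] q \<in> S"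
    using x N u(1) unfolding c0_def P_def q_def by (auto simp: nat_pow_pow mult.commute)
  obtain b where b: "b \<in> S" "c0 [^] q = b [^] q"
    using pure_subgroupD(2)[OF S c0(3) q c0(1)] by blast
  \<comment> \<open>Same coset as \<open>c0\<close>, but its \<open>q\<close>-th power is now
    trivial: \<open>b\<close> is a \<open>q\<close>-th root of \<open>c0 [^] q\<close> that purity
    supplies inside \<open>S\<close>.\<close>
  define c where "c = c0 \<otimes> inv b"
  have bc: "b \<in> carrier G" using b sc by blast
  have cc: "c \<in> carrier G" unfolding c_def using c0 bc by simp
  have cq: "c [^] q = \<one>"
    unfolding c_def using c0 b bc by (simp add: nat_pow_distrib nat_pow_inv)
  have cS: "c [^] (p ^ (n - 1)) \<notin> S"
  proof
    assume "c [^] (p ^ (n - 1)) \<in> S"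
    moreover have "c0 = c \<otimes> b" unfolding c_def using c0 bc by (simp add: m_assoc)
    ultimately have "c0 [^] (p ^ (n - 1)) \<in> S"
      using cc bc b subgroup_pow_closed[OF sub b(1)] subgroup.m_closed[OF sub]
      by (simp add: nat_pow_distrib)
    then show False using c0 by blast
  qed
  \<comment> \<open>By Bezout the power of \<open>c\<close> with exponent \<open>gcd j q\<close>
    also lies in \<open>S\<close>. This gcd is a power of \<open>p\<close>; were it a proper divisor
    of \<open>q\<close>, it would divide \<open>p ^ (n - 1)\<close>, against
    \<open>cS\<close>.\<close>
  have dvd: "q dvd j" if "c [^] j \<in> S" for j :: nat
  proof (cases "j = 0")
    case False
    obtain i where i: "i \<le> n" "gcd j q = p ^ i"
      using divides_primepow_nat[OF p(1), of "gcd j q" n] unfolding q_def by auto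
    obtain v w where "j * v = q * w + gcd j q" using bezout_nat[OF False] by blast
    then have "c [^] (j * v) = c [^] gcd j q"
      using pow_eq_mod[OF cc cq, of "j * v"] pow_eq_mod[OF cc cq, of "gcd j q"] by simp
    then have g: "c [^] gcd j q \<in> S"
      using subgroup_pow_closed[OF sub that, of v] cc by (simp add: nat_pow_pow)
    have "i = n"
    proof (rule ccontr)
      assume "i \<noteq> n"
      then have "n - 1 = i + (n - 1 - i)" using i(1) by simp
      then have "p ^ (n - 1) = p ^ i * p ^ (n - 1 - i)" by (metis power_add)
      then have "c [^] (p ^ (n - 1)) \<in> S"
        using subgroup_pow_closed[OF sub g, of "p ^ (n - 1 - i)"] cc i by (simp add: nat_pow_pow)
      then show False using cS by blast
    qed
    then show ?thesis using i(2) unfolding q_def by (metis gcd_dvd1)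
  qed simp
  have "gcd k q dvd m"
    if s: "s \<in> S" and y: "y \<in> carrier G" and k: "k \<ge> 1" and eq: "s \<otimes> c [^] m = y [^] k"
    for s y and k m :: nat
  proof -
    define d where "d = gcd k q"
    obtain k' q' where kq: "k = d * k'" "q = d * q'" unfolding d_def by (metis dvdE gcd_dvd1 gcd_dvd2)
    \<comment> \<open>The exponent \<open>u * q'\<close> is chosen so that
      \<open>k * u * q' = N * k'\<close>; hence the right side is a power of an \<open>N\<close>-th
      power and lies in \<open>S\<close>. Cancelling the power of \<open>s\<close> leaves a power of
      \<open>c\<close> in \<open>S\<close>, so \<open>d * q'\<close> divides
      \<open>m * u * q'\<close>, and \<open>d\<close> is coprime to \<open>u\<close>.\<close>
    have "(s \<otimes> c [^] m) [^] (u * q') = (y [^] N) [^] k'"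
      unfolding eq u(1) q_def[symmetric] using y kq by (simp add: nat_pow_pow ac_simps)
    moreover have "(y [^] N) [^] k' \<in> S"
      using N y subgroup_pow_closed[OF sub] unfolding P_def by blast
    moreover have "(s \<otimes> c [^] m) [^] (u * q') = s [^] (u * q') \<otimes> c [^] (m * (u * q'))"
      using s sc cc by (simp add: nat_pow_distrib nat_pow_pow)
    ultimately have "s [^] (u * q') \<otimes> c [^] (m * (u * q')) \<in> S" by simp
    then have "inv (s [^] (u * q')) \<otimes> (s [^] (u * q') \<otimes> c [^] (m * (u * q'))) \<in> S"
      by (rule subgroup.m_closed[OF sub subgroup.m_inv_closed[OF sub subgroup_pow_closed[OF sub s]]])
    then have "c [^] (m * (u * q')) \<in> S"
      using s sc cc by (simp add: m_assoc[symmetric])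
    then have "d * q' dvd m * u * q'" using dvd kq by (simp add: ac_simps)
    then have "d dvd m * u" using q kq by auto
    moreover have "coprime d u"
    proof (rule coprime_divisors)
      show "coprime (p ^ n) u" using p(1) u(2) by (simp add: prime_imp_coprime)
      show "d dvd p ^ n" unfolding d_def q_def by simp
    qed simp
    ultimately show ?thesis unfolding d_def using coprime_dvd_mult_left_iff by blast
  qed
  then have "pure_cyclic_over G S c q"
    unfolding pure_cyclic_over_def using cc q cq by blast
  moreover have "c \<notin> S" using cS subgroup_pow_closed[OF sub] by blast
  ultimately show ?thesis using that p(1) unfolding q_def by blast
qed

section \<open>Extending correspondences\<close>

text \<open>Pure-injectivity for finite groups in relational form: the larger group is a finite pure
  subgroup \<open>A\<close> of a group \<open>G\<close> that may be infinite, and the element type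
  \<open>'u\<close> of the class no longer appears.\<close>

definition extends_finite_pure :: "('a, 'm) monoid_scheme \<Rightarrow> ('b, 'n) monoid_scheme \<Rightarrow> bool" where
  "extends_finite_pure G H \<longleftrightarrow>
     (\<forall>A R. finite A \<and> pure_subgroup A G \<and> pure_correspondence G H R \<and> Domain R \<subseteq> A \<longrightarrow>
        (\<exists>R'. R \<subseteq> R' \<and> pure_correspondence G H R' \<and> Domain R' = A))"

lemma extends_finite_pureD:
  assumes "extends_finite_pure G H" "finite A" "pure_subgroup A G" "pure_correspondence G H R"
    "Domain R \<subseteq> A"
  shows "\<exists>R'. R \<subseteq> R' \<and> pure_correspondence G H R' \<and> Domain R' = A"
  using assms unfolding extends_finite_pure_def by simp

lemma finite_pure_correspondence:
  assumes R: "pure_correspondence G H R" and fin: "finite (Domain R)"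
  shows "finite R"
proof -
  obtain f where f: "\<And>x y. (x, y) \<in> R \<Longrightarrow> f x = y"
    using embedding_of_pure_correspondence[OF R] by metis
  have "R \<subseteq> (\<lambda>x. (x, f x)) ` Domain R"
    using f by (force intro: rev_image_eqI)
  then show ?thesis using fin finite_subset by blast
qed

lemma pure_correspondence_trivial:
  assumes "group G" "group H"
  shows "pure_correspondence G H {(\<one>\<^bsub>G\<^esub>, \<one>\<^bsub>H\<^esub>)}"
  unfolding pure_correspondence_def
  using assms group.pure_subgroup_trivial[of G] group.pure_subgroup_trivial[of H]
  by (auto simp: single_valued_def group.is_monoid)

text \<open>Induction on the number of elements outside the domain. A cyclic group over the domain
  is matched with one of the same order over the range; \<open>fresh\<close> provides the latter
  because the range is finite.\<close>

lemma extend_to_finite_group: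
  assumes G: "comm_group G" and H: "comm_group H" and fin: "finite (carrier G)"
    and fresh: "\<And>S p n. \<lbrakk>finite S; S \<subseteq> carrier H; prime p\<rbrakk> \<Longrightarrow> \<exists>e. pure_cyclic_over H S e (p ^ n)"
    and R: "pure_correspondence G H R"
  shows "\<exists>R'. R \<subseteq> R' \<and> pure_correspondence G H R' \<and> Domain R' = carrier G"
  using R
proof (induction "card (carrier G - Domain R)" arbitrary: R rule: less_induct)
  case less
  note R = less.prems
  have pure: "pure_subgroup (Domain R) G" "pure_subgroup (Range R) H"
    using R unfolding pure_correspondence_def by auto
  show ?case
  proof (cases "Domain R = carrier G")
    case True
    then show ?thesis using R by (intro exI[of _ R]) simp
  next
    case False
    obtain c p n where c: "prime p" "pure_cyclic_over G (Domain R) c (p ^ n)" "c \<notin> Domain R"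
      by (rule comm_group.exists_pure_cyclic_over[OF G fin pure(1) False])
    have "finite (Domain R)" using fin pure_subgroup_subset[OF pure(1)] finite_subset by blast
    then have "finite (Range R)" using finite_pure_correspondence[OF R] finite_Range by blast
    then obtain e where e: "pure_cyclic_over H (Range R) e (p ^ n)"
      using fresh pure_subgroup_subset[OF pure(2)] c(1) by blast
    obtain R1 where R1: "R \<subseteq> R1" "pure_correspondence G H R1" "Domain R1 = adjoin G (Domain R) c"
      by (rule pure_correspondence_adjoin[OF G H R c(2) e])
    have cc: "c \<in> carrier G" using c(2) unfolding pure_cyclic_over_def by blast
    \<comment> \<open>Exhibits \<open>c\<close> itself as a member of the adjoined subgroup, so that
      the domain grows strictly.\<close>
    have "c = \<one>\<^bsub>G\<^esub> \<otimes>\<^bsub>G\<^esub> c [^]\<^bsub>G\<^esub> (1::nat)"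
      using cc G by (simp add: comm_group.axioms group.is_monoid comm_groupE)
    then have "c \<in> Domain R1"
      unfolding R1(3) adjoin_def using subgroup.one_closed[OF pure_subgroupD(1)[OF pure(1)]] by blast
    then have "carrier G - Domain R1 \<subset> carrier G - Domain R" using R1(1) c(3) cc by blast
    then have "card (carrier G - Domain R1) < card (carrier G - Domain R)"
      using fin by (intro psubset_card_mono) auto
    from less.hyps[OF this R1(2)] obtain R' where
      "R1 \<subseteq> R'" "pure_correspondence G H R'" "Domain R' = carrier G" by (elim exE conjE)
    then show ?thesis using R1(1) by (intro exI[of _ R'] conjI) (rule subset_trans)
  qed
qed

lemma pure_injective_if_extends:
  assumes H: "comm_group H"
    and ext: "\<And>C :: 'u monoid. C \<in> finite_abelian_groups \<Longrightarrow> extends_finite_pure C H"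
  shows "pure_injective_for H (finite_abelian_groups :: 'u monoid set)"
  unfolding pure_injective_for_def
proof (intro ballI allI impI, elim conjE)
  fix C :: "'u monoid" and B f
  assume C: "C \<in> finite_abelian_groups" and B: "pure_subgroup B C"
    and f: "pure_embedding (C\<lparr>carrier := B\<rparr>) H f"
  have CC: "group C" "finite (carrier C)" and HH: "group H"
    using C H unfolding finite_abelian_groups_def by (auto intro: comm_group.axioms)
  let ?R = "(\<lambda>x. (x, f x)) ` B"
  have R: "pure_correspondence C H ?R"
    using pure_correspondence_of_embedding[OF CC(1) HH B f] .
  moreover have "Domain ?R \<subseteq> carrier C" using pure_subgroup_subset[OF B] by auto
  ultimately obtain R' where R': "?R \<subseteq> R'" "pure_correspondence C H R'" "Domain R' = carrier C"
    using extends_finite_pureD[OF ext[OF C] CC(2) group.pure_subgroup_self[OF CC(1)]] by meson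
  obtain g where g: "pure_embedding (C\<lparr>carrier := Domain R'\<rparr>) H g" "\<And>x y. (x, y) \<in> R' \<Longrightarrow> g x = y"
    using embedding_of_pure_correspondence[OF R'(2)] by blast
  have "\<forall>x\<in>B. g x = f x" using g(2) R'(1) by blast
  then show "\<exists>g. pure_embedding C H g \<and> (\<forall>x\<in>B. g x = f x)"
    using g(1) R'(3) by auto
qed

section \<open>Transfer to copies over the element type of the class\<close>

lemma finite_copy:
  assumes G: "comm_group G" and A: "pure_subgroup A G" "finite A" and inf: "infinite (UNIV :: 'u set)"
  obtains C :: "'u monoid" and R where "C \<in> finite_abelian_groups"
    "pure_correspondence G C R" "Domain R = A" "Range R = carrier C"
proof -
  \<comment> \<open>Infinity of the type \<open>'u\<close> enters here: it gives a set of the size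
    of \<open>A\<close>, to which the group structure is transported along a bijection.\<close>
  obtain B :: "'u set" where B: "finite B" "card B = card A"
    using infinite_arbitrarily_large[OF inf] by blast
  then obtain h where h: "bij_betw h A B"
    using A(2) finite_same_card_bij by metis
  let ?A = "G\<lparr>carrier := A\<rparr>"
  have AG: "comm_group ?A" using comm_group.comm_group_subgroup[OF G pure_subgroupD(1)[OF A(1)]] .
  then interpret A: comm_group ?A .
  define C where "C = image_group h ?A"
  have inj: "inj_on h (carrier ?A)" using h by (simp add: bij_betw_def)
  have C: "group C" unfolding C_def using A.inj_imp_image_group_is_group[OF inj] .
  have iso: "h \<in> iso ?A C" unfolding C_def using inj_imp_image_group_iso[OF inj] .
  have car: "carrier C = h ` A" unfolding C_def by (simp add: image_group_carrier)
  have "comm_group C"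
    using A.iso_imp_comm_group[OF is_isoI[OF iso]] C by (simp add: group.is_monoid)
  then have "C \<in> finite_abelian_groups"
    unfolding finite_abelian_groups_def using car A(2) by simp
  moreover have "pure_embedding ?A C h"
    using iso group.pure_subgroup_self[OF C] car
    unfolding pure_embedding_def iso_def mon_def bij_betw_def by simp
  then have "pure_correspondence G C ((\<lambda>x. (x, h x)) ` A)"
    using pure_correspondence_of_embedding[OF _ C A(1)] G by (simp add: comm_group.axioms)
  moreover have "Domain ((\<lambda>x. (x, h x)) ` A) = A" "Range ((\<lambda>x. (x, h x)) ` A) = carrier C"
    unfolding car by force+
  ultimately show ?thesis using that by blast
qed

text \<open>\<open>A\<close> is copied by \<open>T\<close> to a group \<open>C\<close> of the class.
  The given \<open>R\<close> becomes a pure embedding of a pure subgroup of \<open>C\<close>, which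
  extends to \<open>C\<close>; composing with \<open>T\<close> returns an extension on
  \<open>A\<close>.\<close>

lemma extends_if_pure_injective:
  assumes G: "comm_group G" and H: "comm_group H" and inf: "infinite (UNIV :: 'u set)"
    and inj: "pure_injective_for H (finite_abelian_groups :: 'u monoid set)"
  shows "extends_finite_pure G H"
  unfolding extends_finite_pure_def
proof (intro allI impI, elim conjE)
  fix A R assume fin: "finite A" and A: "pure_subgroup A G" and R: "pure_correspondence G H R"
    and sub: "Domain R \<subseteq> A"
  obtain C :: "'u monoid" and T where C: "C \<in> finite_abelian_groups" and T: "pure_correspondence G C T"
    and DT: "Domain T = A" and RT: "Range T = carrier C"
    by (rule finite_copy[OF G A fin inf])
  have CC: "comm_group C" using C unfolding finite_abelian_groups_def by simp
  note gr = comm_group.axioms(2)[OF G] comm_group.axioms(2)[OF H] comm_group.axioms(2)[OF CC]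
  let ?S = "T\<inverse> O R"
  have S: "pure_correspondence C H ?S"
    using pure_correspondence_comp'[OF gr(3,1,2) pure_correspondence_converse[OF T] R] sub DT by simp
  then have B: "pure_subgroup (Domain ?S) C" unfolding pure_correspondence_def by blast
  obtain f where f: "pure_embedding (C\<lparr>carrier := Domain ?S\<rparr>) H f" "\<And>x y. (x, y) \<in> ?S \<Longrightarrow> f x = y"
    using embedding_of_pure_correspondence[OF S] by blast
  have "C\<lparr>carrier := Domain ?S\<rparr> \<in> finite_abelian_groups"
    using C B comm_group.comm_group_subgroup[OF CC pure_subgroupD(1)[OF B]] pure_subgroup_subset[OF B]
    unfolding finite_abelian_groups_def by (auto intro: finite_subset)
  then obtain g where g: "pure_embedding C H g" "\<forall>x\<in>Domain ?S. g x = f x"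
    using inj C B f(1) unfolding pure_injective_for_def by blast
  let ?U = "(\<lambda>x. (x, g x)) ` carrier C"
  have U: "pure_correspondence C H ?U"
    using pure_correspondence_of_embedding[OF gr(3,2) group.pure_subgroup_self[OF gr(3)]] g(1) by simp
  have DU: "Domain ?U = carrier C" by force
  have "pure_correspondence G H (T O ?U)"
    using pure_correspondence_comp[OF gr(1,3,2) T U] RT DU by simp
  moreover have "Domain (T O ?U) = A" using DT RT DU by blast
  moreover have "R \<subseteq> T O ?U"
  proof
    fix z assume z: "z \<in> R"
    obtain x y where xy: "z = (x, y)" by fastforce
    then obtain t where t: "(x, t) \<in> T" using z sub DT by blast
    then have "(t, y) \<in> ?S" using z xy by blast
    then have "g t = y" using f(2) g(2) by blast
    then have "(t, y) \<in> ?U" using t RT by blast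
    then show "z \<in> T O ?U" using t xy by blast
  qed
  ultimately show "\<exists>R'. R \<subseteq> R' \<and> pure_correspondence G H R' \<and> Domain R' = A" by blast
qed

section \<open>Back and forth along chains of finite pure subgroups\<close>

lemma finite_subset_chain_member:
  fixes C :: "nat \<Rightarrow> 'a set"
  assumes "mono C" "finite S" "S \<subseteq> (\<Union>n. C n)"
  obtains n where "S \<subseteq> C n"
proof -
  have "\<exists>n. S \<subseteq> C n"
    using assms(2,3)
  proof (induction S)
    case (insert x S)
    then obtain m n where "S \<subseteq> C m" "x \<in> C n" by auto
    then have "insert x S \<subseteq> C (max m n)"
      using monoD[OF assms(1), of m "max m n"] monoD[OF assms(1), of n "max m n"] by auto
    then show ?case by blast
  qed simp
  then show ?thesis using that by blast
qed

text \<open>Only pure subgroups are admissible as new domains, and the union of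
  \<open>Domain R\<close> and \<open>C n\<close> need not be one. A later member \<open>C m\<close>
  containing both is used instead.\<close>

lemma extend_over_chain:
  fixes C :: "nat \<Rightarrow> 'a set"
  assumes ext: "extends_finite_pure G H" and C: "mono C" "\<And>n. finite (C n) \<and> pure_subgroup (C n) G"
    "carrier G = (\<Union>n. C n)"
    and R: "finite R" "pure_correspondence G H R"
  shows "\<exists>R'. finite R' \<and> pure_correspondence G H R' \<and> R \<subseteq> R' \<and> C n \<subseteq> Domain R'"
proof -
  have "Domain R \<subseteq> carrier G" using R(2) pure_subgroup_subset unfolding pure_correspondence_def by blast
  then have "Domain R \<union> C n \<subseteq> (\<Union>n. C n)" using C(3) by blast
  moreover have "finite (Domain R \<union> C n)" using R(1) C(2) by (simp add: finite_Domain)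
  ultimately obtain m where m: "Domain R \<union> C n \<subseteq> C m"
    using finite_subset_chain_member[OF C(1)] by metis
  then obtain R' where R': "R \<subseteq> R'" "pure_correspondence G H R'" "Domain R' = C m"
    using extends_finite_pureD[OF ext _ _ R(2), of "C m"] C(2)[of m] by auto
  then have "finite R'" using finite_pure_correspondence C(2)[of m] by metis
  moreover have "C n \<subseteq> Domain R'" using m R'(3) by simp
  ultimately show ?thesis using R'(1,2) by (intro exI[of _ R']) simp
qed

lemma back_and_forth:
  assumes G: "comm_group G" and H: "comm_group H"
    and ext: "extends_finite_pure G H" "extends_finite_pure H G"
    and chain: "union_of_finite_pure_chain G" "union_of_finite_pure_chain H"
  shows "G \<cong> H"
proof -
  obtain C :: "nat \<Rightarrow> _" where C: "mono C" "\<And>n. finite (C n) \<and> pure_subgroup (C n) G" "carrier G = (\<Union>n. C n)"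
    using chain(1) unfolding union_of_finite_pure_chain_def by blast
  obtain D :: "nat \<Rightarrow> _" where D: "mono D" "\<And>n. finite (D n) \<and> pure_subgroup (D n) H" "carrier H = (\<Union>n. D n)"
    using chain(2) unfolding union_of_finite_pure_chain_def by blast
  note gr = comm_group.axioms(2)[OF G] comm_group.axioms(2)[OF H]
  define P where "P R \<longleftrightarrow> finite R \<and> pure_correspondence G H R" for R
  \<comment> \<open>One round: extend forth to cover \<open>C n\<close>, then extend the converse to
    cover \<open>D n\<close>.\<close>
  have step: "\<exists>R'. P R' \<and> R \<subseteq> R' \<and> C n \<subseteq> Domain R' \<and> D n \<subseteq> Range R'" if "P R" for R n
  proof -
    obtain R1 where R1: "P R1" "R \<subseteq> R1" "C n \<subseteq> Domain R1"
      using extend_over_chain[OF ext(1) C, of R n] \<open>P R\<close> unfolding P_def by auto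
    obtain R2 where R2: "finite R2" "pure_correspondence H G R2" "R1\<inverse> \<subseteq> R2" "D n \<subseteq> Domain R2"
      using extend_over_chain[OF ext(2) D, of "R1\<inverse>" n] R1(1)
        pure_correspondence_converse[of G H R1]
      unfolding P_def by auto
    have "P (R2\<inverse>)" using R2(1) pure_correspondence_converse[OF R2(2)] unfolding P_def by simp
    moreover have "R1 \<subseteq> R2\<inverse>" using R2(3) by (metis converse_converse converse_mono)
    ultimately show ?thesis
      using R1 R2(4) Domain_mono[of R1 "R2\<inverse>"]
      by (intro exI[of _ "R2\<inverse>"]) (simp only: Range_converse Domain_converse, blast)
  qed
  have "\<exists>F. \<forall>n. P (F n) \<and> (F n \<subseteq> F (Suc n) \<and> C n \<subseteq> Domain (F (Suc n)) \<and> D n \<subseteq> Range (F (Suc n)))"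
    by (rule dependent_nat_choice)
      (use pure_correspondence_trivial[OF gr] step in \<open>auto simp: P_def\<close>)
  then obtain F where F: "\<And>n. P (F n)" "\<And>n. F n \<subseteq> F (Suc n)"
    "\<And>n. C n \<subseteq> Domain (F (Suc n))" "\<And>n. D n \<subseteq> Range (F (Suc n))"
    by blast
  have mono: "F m \<subseteq> F n" if "m \<le> n" for m n
    using lift_Suc_mono_le[of F, OF F(2) that] .
  have pc: "pure_correspondence G H (F n)" for n using F(1) unfolding P_def by blast
  define U where "U = (\<Union>n. F n)"
  have FU: "F n \<subseteq> U" for n unfolding U_def by blast
  \<comment> \<open>Single-valuedness and compatibility with products concern two pairs at a time,
    so they pass from the stages \<open>F n\<close> to the union.\<close>
  have common: "\<exists>n. (x, y) \<in> F n \<and> (x', y') \<in> F n" if xy: "(x, y) \<in> U" "(x', y') \<in> U" for x y x' y'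
  proof -
    obtain m n where "(x, y) \<in> F m" "(x', y') \<in> F n" using xy unfolding U_def by blast
    then show ?thesis using mono[of m "max m n"] mono[of n "max m n"] by auto
  qed
  have dom: "Domain U = carrier G"
  proof
    show "Domain U \<subseteq> carrier G"
      using pure_correspondence_carrier(1)[OF pc] unfolding U_def by (auto simp only: Domain_iff UN_iff)
    show "carrier G \<subseteq> Domain U"
      unfolding C(3) by (intro UN_least order_trans[OF F(3)] Domain_mono FU)
  qed
  have ran: "Range U = carrier H"
  proof
    show "Range U \<subseteq> carrier H"
      using pure_correspondence_carrier(2)[OF pc] unfolding U_def by (auto simp only: Range_iff UN_iff)
    show "carrier H \<subseteq> Range U"
      unfolding D(3) by (intro UN_least order_trans[OF F(4)] Range_mono FU)
  qed
  have "x = x' \<longleftrightarrow> y = y'" if "(x, y) \<in> U" "(x', y') \<in> U" for x y x' y'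
    using common[OF that] by (elim exE conjE) (rule pure_correspondence_unique[OF pc])
  then have "single_valued U" "single_valued (U\<inverse>)"
    unfolding single_valued_def converse_iff by blast+
  moreover have "(x \<otimes>\<^bsub>G\<^esub> x', y \<otimes>\<^bsub>H\<^esub> y') \<in> U" if xy: "(x, y) \<in> U" "(x', y') \<in> U" for x y x' y'
  proof -
    obtain n where "(x, y) \<in> F n" "(x', y') \<in> F n" using common[OF xy] by blast
    then have "(x \<otimes>\<^bsub>G\<^esub> x', y \<otimes>\<^bsub>H\<^esub> y') \<in> F n" by (rule pure_correspondence_mult[OF pc])
    then show ?thesis unfolding U_def by blast
  qed
  ultimately have U: "pure_correspondence G H U"
    unfolding pure_correspondence_def dom ran
    using group.pure_subgroup_self[OF gr(1)] group.pure_subgroup_self[OF gr(2)] by simp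
  obtain f where f: "pure_embedding (G\<lparr>carrier := Domain U\<rparr>) H f" "\<And>x y. (x, y) \<in> U \<Longrightarrow> f x = y"
    using embedding_of_pure_correspondence[OF U] by blast
  have "f ` Domain U = Range U"
    using f(2) by (auto intro!: rev_image_eqI)
  then have "f ` carrier G = carrier H"
    unfolding dom ran .
  then have "f \<in> iso G H"
    using f(1) dom unfolding pure_embedding_def mon_def iso_def bij_betw_def by simp
  then show ?thesis by (rule is_isoI)
qed

text \<open>Embed \<open>b\<close> into \<open>U\<close>, which also embeds \<open>a\<close>; then
  extend the resulting partial map on the image of \<open>a\<close> in \<open>c\<close> to all of
  \<open>c\<close>. Both images lie in one finite pure member of the chain, and a copy of it is the
  amalgam.\<close>

lemma amalgamation_from_extension:
  assumes U: "comm_group U" and chain: "union_of_finite_pure_chain U"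
    and inf: "infinite (UNIV :: 'u set)"
    and ext: "\<And>C :: 'u monoid. C \<in> finite_abelian_groups \<Longrightarrow> extends_finite_pure C U"
  shows "amalgamation_property (finite_abelian_groups :: 'u monoid set)"
  unfolding amalgamation_property_def
proof (intro ballI allI impI, elim conjE)
  fix a b c :: "'u monoid" and f g
  assume a: "a \<in> finite_abelian_groups" and b: "b \<in> finite_abelian_groups"
    and c: "c \<in> finite_abelian_groups"
    and f: "pure_embedding a b f" and g: "pure_embedding a c g"
  have ga: "group a" and gb: "group b" and gc: "group c" and gU: "group U"
    and finb: "finite (carrier b)" and finc: "finite (carrier c)"
    using a b c U comm_group.axioms(2) unfolding finite_abelian_groups_def by auto
  let ?f = "(\<lambda>x. (x, f x)) ` carrier a" and ?g = "(\<lambda>x. (x, g x)) ` carrier a"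
  have F: "pure_correspondence a b ?f" and G: "pure_correspondence a c ?g"
    using pure_correspondence_of_embedding[OF ga _ group.pure_subgroup_self[OF ga]] f g gb gc by auto
  have "Domain {(\<one>\<^bsub>b\<^esub>, \<one>\<^bsub>U\<^esub>)} \<subseteq> carrier b" using gb by (simp add: group.is_monoid)
  then obtain R where R: "pure_correspondence b U R" "Domain R = carrier b"
    using extends_finite_pureD[OF ext[OF b] finb group.pure_subgroup_self[OF gb]
      pure_correspondence_trivial[OF gb gU]] by meson
  have "Range ?f \<subseteq> carrier b" using pure_correspondence_carrier(2)[OF F] by blast
  then have FR: "pure_correspondence a U (?f O R)"
    using pure_correspondence_comp[OF ga gb gU F R(1)] R(2) by simp
  have "Range (?g\<inverse>) \<subseteq> Domain (?f O R)"
    using R(2) \<open>Range ?f \<subseteq> carrier b\<close> by blast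
  \<comment> \<open>This partial map on \<open>c\<close> takes \<open>g x\<close> to the image of
    \<open>f x\<close> under \<open>R\<close>; any extension of it makes the square commute.\<close>
  then have S0: "pure_correspondence c U (?g\<inverse> O (?f O R))"
    using pure_correspondence_comp[OF gc ga gU pure_correspondence_converse[OF G] FR] by simp
  then have "Domain (?g\<inverse> O (?f O R)) \<subseteq> carrier c"
    using pure_correspondence_carrier(1)[OF S0] by blast
  then obtain S where S: "?g\<inverse> O (?f O R) \<subseteq> S" "pure_correspondence c U S" "Domain S = carrier c"
    using extends_finite_pureD[OF ext[OF c] finc group.pure_subgroup_self[OF gc] S0] by meson
  obtain N :: "nat \<Rightarrow> _" where N: "mono N" "\<And>n. finite (N n) \<and> pure_subgroup (N n) U" "carrier U = (\<Union>n. N n)"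
    using chain unfolding union_of_finite_pure_chain_def by blast
  have "finite (Range R \<union> Range S)"
    using finite_pure_correspondence R S(2,3) finb finc by (metis finite_Range finite_Un)
  moreover have "Range R \<union> Range S \<subseteq> carrier U"
    using pure_correspondence_carrier(2)[OF R(1)] pure_correspondence_carrier(2)[OF S(2)] by blast
  ultimately obtain n where n: "Range R \<union> Range S \<subseteq> N n"
    using finite_subset_chain_member[OF N(1)] N(3) by metis
  obtain d :: "'u monoid" and T where d: "d \<in> finite_abelian_groups" and T: "pure_correspondence U d T"
    and DT: "Domain T = N n"
    by (rule finite_copy[OF U conjunct2[OF N(2)] conjunct1[OF N(2)] inf])
  have gd: "group d" using d comm_group.axioms(2) unfolding finite_abelian_groups_def by auto
  have RT: "pure_correspondence b d (R O T)" and ST: "pure_correspondence c d (S O T)"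
    using pure_correspondence_comp[OF gb gU gd R(1) T] pure_correspondence_comp[OF gc gU gd S(2) T] n DT
    by auto
  have dR: "Domain (R O T) = carrier b" and dS: "Domain (S O T) = carrier c"
    using R(2) S(3) n DT by blast+
  obtain f' where f': "pure_embedding (b\<lparr>carrier := Domain (R O T)\<rparr>) d f'" "\<And>x y. (x, y) \<in> R O T \<Longrightarrow> f' x = y"
    using embedding_of_pure_correspondence[OF RT] by blast
  obtain g' where g': "pure_embedding (c\<lparr>carrier := Domain (S O T)\<rparr>) d g'" "\<And>x y. (x, y) \<in> S O T \<Longrightarrow> g' x = y"
    using embedding_of_pure_correspondence[OF ST] by blast
  have "f' (f x) = g' (g x)" if x: "x \<in> carrier a" for x
  proof -
    have "f x \<in> Domain R" using x \<open>Range ?f \<subseteq> carrier b\<close> R(2) by blast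
    then obtain y where y: "(f x, y) \<in> R" by blast
    then have "(g x, y) \<in> ?g\<inverse> O (?f O R)" using x by blast
    then have "(g x, y) \<in> S" using S(1) by blast
    moreover obtain z where "(y, z) \<in> T" using y n DT by blast
    ultimately have "(f x, z) \<in> R O T" "(g x, z) \<in> S O T" using y by blast+
    then show ?thesis using f'(2) g'(2) by metis
  qed
  moreover have "pure_embedding b d f'" "pure_embedding c d g'"
    using f'(1) g'(1) unfolding dR dS by simp_all
  ultimately show "\<exists>d\<in>finite_abelian_groups :: 'u monoid set. \<exists>f' g'. pure_embedding b d f' \<and> pure_embedding c d g' \<and>
      (\<forall>x\<in>carrier a. f' (f x) = g' (g x))"
    by (intro bexI[OF _ d] exI[of _ f'] exI[of _ g']) simp
qed

section \<open>The direct sum of cyclic groups\<close>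

text \<open>If \<open>a = b [^] k\<close> and \<open>a\<close> is in the image, applying
  \<open>r\<close> fixes \<open>a\<close> and replaces \<open>b\<close> by the root
  \<open>r b\<close> in the image.\<close>

lemma pure_subgroup_retract:
  assumes G: "group G" and r: "r \<in> hom G G" and idem: "\<And>x. x \<in> carrier G \<Longrightarrow> r (r x) = r x"
  shows "pure_subgroup (r ` carrier G) G"
  unfolding pure_subgroup_def
proof (intro conjI ballI allI impI)
  have hom: "group_hom G G r"
    using G r by (simp add: group_hom_def group_hom_axioms_def)
  then show "subgroup (r ` carrier G) G" by (rule group_hom.img_is_subgroup)
  fix a and k :: nat
  assume "a \<in> r ` carrier G" "\<exists>b\<in>carrier G. a = b [^]\<^bsub>G\<^esub> k"
  then obtain b where b: "b \<in> carrier G" "a = b [^]\<^bsub>G\<^esub> k" by blast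
  have "r a = a" using \<open>a \<in> r ` carrier G\<close> idem by auto
  then have "a = r b [^]\<^bsub>G\<^esub> k" using group_hom.hom_nat_pow[OF hom b(1), of k] b(2) by simp
  then show "\<exists>a'\<in>r ` carrier G. a = a' [^]\<^bsub>G\<^esub> k" using b(1) by blast
qed

section \<open>Coordinatewise description of \<open>F0\<close>\<close>

lemma comm_group_F0: "comm_group F0"
proof (rule group.group_comm_groupI)
  show "group F0" unfolding F0_def by simp
qed (simp add: F0_def add.commute)

lemma group_F0: "group F0"
  using comm_group_F0 by (rule comm_group.axioms(2))

lemma one_F0: "\<one>\<^bsub>F0\<^esub> = (\<lambda>j. \<lambda>p\<in>{p. prime p}. \<lambda>n. 0)"
  unfolding F0_def by (simp add: restrict_UNIV)

lemma mult_F0: "x \<otimes>\<^bsub>F0\<^esub> y = (\<lambda>j. \<lambda>p\<in>{p. prime p}. \<lambda>n. (x j p n + y j p n) mod int (p ^ n))"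
  unfolding F0_def by (simp add: restrict_UNIV)

text \<open>Each of the three nested sums contributes its own finiteness condition. Since the middle
  sum is indexed by primes only, elements are \<open>undefined\<close> at other
  \<open>p\<close>.\<close>

lemma carrier_F0_iff:
  "x \<in> carrier F0 \<longleftrightarrow>
     (\<forall>j p. \<not> prime p \<longrightarrow> x j p = undefined) \<and>
     (\<forall>j p n. prime p \<longrightarrow> x j p n \<in> {0..<int (p ^ n)}) \<and>
     finite {j. x j \<noteq> (\<lambda>p\<in>{p. prime p}. \<lambda>n. 0)} \<and>
     (\<forall>j. finite {p. prime p \<and> x j p \<noteq> (\<lambda>n. 0)}) \<and>
     (\<forall>j p. prime p \<longrightarrow> finite {n. x j p n \<noteq> 0})"
  unfolding F0_def
  by (auto simp: carrier_sum_group PiE_iff extensional_def carrier_integer_mod_group restrict_UNIV)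

lemma F0_finite_support:
  assumes "x \<in> carrier F0"
  shows "finite {(j, p, n). prime p \<and> x j p n \<noteq> 0}"
proof -
  let ?J = "{j. x j \<noteq> (\<lambda>p\<in>{p. prime p}. \<lambda>n. 0)}" and ?P = "\<lambda>j. {p. prime p \<and> x j p \<noteq> (\<lambda>n. 0)}"
    and ?N = "\<lambda>j p. {n. x j p n \<noteq> 0}"
  have "finite (SIGMA j:?J. SIGMA p:?P j. ?N j p)"
    using assms unfolding carrier_F0_iff by (intro finite_SigmaI) auto
  moreover have "{(j, p, n). prime p \<and> x j p n \<noteq> 0} \<subseteq> (SIGMA j:?J. SIGMA p:?P j. ?N j p)"
    by auto
  ultimately show ?thesis by (rule finite_subset[rotated])
qed

text \<open>The supports at the three levels are contained in projections of the single finite set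
  of triples.\<close>

lemma carrier_F0I:
  assumes ext: "\<And>j p. \<not> prime p \<Longrightarrow> x j p = undefined"
    and range: "\<And>j p n. prime p \<Longrightarrow> x j p n \<in> {0..<int (p ^ n)}"
    and fin: "finite {(j, p, n). prime p \<and> x j p n \<noteq> 0}"
  shows "x \<in> carrier F0"
proof -
  let ?T = "{(j, p, n). prime p \<and> x j p n \<noteq> 0}"
  have "{j. x j \<noteq> (\<lambda>p\<in>{p. prime p}. \<lambda>n. 0)} \<subseteq> fst ` ?T"
  proof
    fix j assume j: "j \<in> {j. x j \<noteq> (\<lambda>p\<in>{p. prime p}. \<lambda>n. 0)}"
    show "j \<in> fst ` ?T"
    proof (rule ccontr)
      assume "j \<notin> fst ` ?T"
      then have "x j p n = 0" if "prime p" for p n using that by (force simp: image_iff)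
      then have "x j = (\<lambda>p\<in>{p. prime p}. \<lambda>n. 0)"
        using ext by (simp add: fun_eq_iff restrict_def)
      then show False using j by simp
    qed
  qed
  moreover have "{p. prime p \<and> x j p \<noteq> (\<lambda>n. 0)} \<subseteq> (\<lambda>(j, p, n). p) ` ?T" for j
  proof
    fix p assume "p \<in> {p. prime p \<and> x j p \<noteq> (\<lambda>n. 0)}"
    then obtain n where "(j, p, n) \<in> ?T" by (auto simp: fun_eq_iff)
    then show "p \<in> (\<lambda>(j, p, n). p) ` ?T" by (rule rev_image_eqI) simp
  qed
  moreover have "{n. x j p n \<noteq> 0} \<subseteq> (\<lambda>(j, p, n). n) ` ?T" if "prime p" for j p
  proof
    fix n assume "n \<in> {n. x j p n \<noteq> 0}"
    then have "(j, p, n) \<in> ?T" using that by simp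
    then show "n \<in> (\<lambda>(j, p, n). n) ` ?T" by (rule rev_image_eqI) simp
  qed
  ultimately show ?thesis
    unfolding carrier_F0_iff using ext range fin by (meson finite_imageI finite_subset)
qed

lemma pow_F0:
  assumes "x \<in> carrier F0"
  shows "x [^]\<^bsub>F0\<^esub> (k::nat) = (\<lambda>j. \<lambda>p\<in>{p. prime p}. \<lambda>n. (int k * x j p n) mod int (p ^ n))"
proof (induction k)
  case (Suc k)
  then show ?case
    by (auto simp: mult_F0 fun_eq_iff algebra_simps mod_simps)
qed (simp add: one_F0)

text \<open>Choose \<open>j\<close> where every member of \<open>S\<close> vanishes and let
  \<open>e\<close> generate the summand at \<open>(j, p, n)\<close>. In that coordinate the equation
  reads \<open>m = k * y\<close> modulo \<open>p ^ n\<close>, and \<open>gcd k (p ^ n)\<close>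
  divides both \<open>k\<close> and the modulus.\<close>

lemma F0_pure_cyclic_over:
  assumes S: "finite S" "S \<subseteq> carrier F0" and p: "prime p"
  shows "\<exists>e. pure_cyclic_over F0 S e (p ^ n)"
proof -
  have "finite (\<Union>s\<in>S. {j. s j \<noteq> (\<lambda>p\<in>{p. prime p}. \<lambda>n. 0)})"
    by (rule finite_UN_I[OF S(1)]) (use S(2) carrier_F0_iff in blast)
  then obtain j where "j \<notin> (\<Union>s\<in>S. {j. s j \<noteq> (\<lambda>p\<in>{p. prime p}. \<lambda>n. 0)})"
    using ex_new_if_finite[OF infinite_UNIV_nat] by blast
  then have Sj: "s j p n = 0" if "s \<in> S" for s using that p by auto
  \<comment> \<open>The entry is \<open>1 mod int (p ^ n)\<close> rather than 1 so that it is a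
    legal residue also for \<open>n = 0\<close>, where the summand is trivial.\<close>
  define e where "e = (\<lambda>i. \<lambda>r\<in>{r. prime r}. \<lambda>l. if i = j \<and> r = p \<and> l = n then 1 mod int (p ^ n) else 0)"
  have ejp: "e j p n = 1 mod int (p ^ n)" unfolding e_def using p by simp
  have e: "e \<in> carrier F0"
  proof (rule carrier_F0I)
    have "{(i, r, l). prime r \<and> e i r l \<noteq> 0} \<subseteq> {(j, p, n)}"
      unfolding e_def by (auto split: if_splits)
    then show "finite {(i, r, l). prime r \<and> e i r l \<noteq> 0}" by (rule finite_subset) simp
  qed (use p in \<open>auto simp: e_def prime_gt_0_nat\<close>)
  have "e [^]\<^bsub>F0\<^esub> (p ^ n) = \<one>\<^bsub>F0\<^esub>"
    unfolding pow_F0[OF e] one_F0 by (auto simp: fun_eq_iff e_def)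
  moreover have "gcd k (p ^ n) dvd m"
    if s: "s \<in> S" and y: "y \<in> carrier F0" and eq: "s \<otimes>\<^bsub>F0\<^esub> e [^]\<^bsub>F0\<^esub> m = y [^]\<^bsub>F0\<^esub> k" for s y and k m :: nat
  proof -
    have "(s \<otimes>\<^bsub>F0\<^esub> e [^]\<^bsub>F0\<^esub> m) j p n = int m mod int (p ^ n)"
      using p unfolding mult_F0 pow_F0[OF e] by (simp add: Sj[OF s] ejp mod_simps)
    moreover have "(y [^]\<^bsub>F0\<^esub> k) j p n = (int k * y j p n) mod int (p ^ n)"
      using p unfolding pow_F0[OF y] by simp
    ultimately have "int m mod int (p ^ n) = (int k * y j p n) mod int (p ^ n)"
      using eq by simp
    moreover have g: "int (gcd k (p ^ n)) dvd int k" "int (gcd k (p ^ n)) dvd int (p ^ n)"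
      unfolding int_dvd_int_iff by simp_all
    moreover have "int (gcd k (p ^ n)) dvd (int k * y j p n) mod int (p ^ n)"
      using g by (intro dvd_mod dvd_mult2)
    ultimately have "int (gcd k (p ^ n)) dvd int m"
      by (metis dvd_mod_iff)
    then show ?thesis by simp
  qed
  moreover have "p ^ n \<ge> 1" using p by (simp add: Suc_le_eq prime_gt_0_nat)
  ultimately show ?thesis unfolding pure_cyclic_over_def using e by blast
qed

text \<open>Truncating all three indices below \<open>N\<close> is a retraction, so its image is
  pure; finite support puts each element in some image.\<close>

lemma union_of_finite_pure_chain_F0: "union_of_finite_pure_chain F0"
proof -
  define r :: "nat \<Rightarrow> (nat \<Rightarrow> nat \<Rightarrow> nat \<Rightarrow> int) \<Rightarrow> _" where
    "r N x = (\<lambda>j. \<lambda>p\<in>{p. prime p}. \<lambda>n. if j < N \<and> p < N \<and> n < N then x j p n else 0)" for N x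
  have rc: "r N x \<in> carrier F0" if x: "x \<in> carrier F0" for N x
  proof (rule carrier_F0I)
    have "{(j, p, n). prime p \<and> r N x j p n \<noteq> 0} \<subseteq> {(j, p, n). prime p \<and> x j p n \<noteq> 0}"
      unfolding r_def by (auto split: if_splits)
    then show "finite {(j, p, n). prime p \<and> r N x j p n \<noteq> 0}"
      using F0_finite_support[OF x] by (rule finite_subset)
  qed (use x in \<open>auto simp: r_def carrier_F0_iff prime_gt_0_nat\<close>)
  \<comment> \<open>Yields idempotence for \<open>M = N\<close> and monotonicity of the images for
    \<open>M \<le> N\<close>.\<close>
  have rr: "r M (r N x) = r (min M N) x" for M N x
    unfolding r_def by (auto simp: fun_eq_iff)
  have hom: "r N \<in> hom F0 F0" for N
    by (rule homI) (auto simp: rc, auto simp: r_def mult_F0 fun_eq_iff)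
  define H where "H N = r N ` carrier F0" for N
  have pure: "pure_subgroup (H N) F0" for N
    unfolding H_def by (rule pure_subgroup_retract[OF group_F0 hom]) (simp add: rr)
  have fin: "finite (H N)" for N
  proof -
    let ?I = "{..<N} \<times> {p. prime p \<and> p < N} \<times> {..<N}"
    \<comment> \<open>\<open>\<Phi>\<close> rebuilds a truncated element from its coordinates in
      \<open>?I\<close>, exhibiting \<open>H N\<close> as part of the image of a finite
      product.\<close>
    define \<Phi> :: "(nat \<times> nat \<times> nat \<Rightarrow> int) \<Rightarrow> nat \<Rightarrow> nat \<Rightarrow> nat \<Rightarrow> int" where
      "\<Phi> g = (\<lambda>j. \<lambda>p\<in>{p. prime p}. \<lambda>n. if j < N \<and> p < N \<and> n < N then g (j, p, n) else 0)" for g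
    have "H N \<subseteq> \<Phi> ` (\<Pi>\<^sub>E (j, p, n)\<in>?I. {0..<int (p ^ n)})"
    proof
      fix z assume "z \<in> H N"
      then obtain x where x: "x \<in> carrier F0" "z = r N x" unfolding H_def by blast
      have "z = \<Phi> (\<lambda>(j, p, n)\<in>?I. x j p n)"
        unfolding x(2) r_def \<Phi>_def by (auto simp: fun_eq_iff)
      moreover have "(\<lambda>(j, p, n)\<in>?I. x j p n) \<in> (\<Pi>\<^sub>E (j, p, n)\<in>?I. {0..<int (p ^ n)})"
        using x(1) unfolding carrier_F0_iff by (auto simp: PiE_iff)
      ultimately show "z \<in> \<Phi> ` (\<Pi>\<^sub>E (j, p, n)\<in>?I. {0..<int (p ^ n)})" by blast
    qed
    moreover have "finite (\<Pi>\<^sub>E (j, p, n)\<in>?I. {0..<int (p ^ n)})"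
      by (rule finite_PiE) auto
    ultimately show ?thesis by (meson finite_imageI finite_subset)
  qed
  have "mono H"
  proof (rule monoI)
    fix M N :: nat assume "M \<le> N"
    then have "r M x = r N (r M x)" for x by (simp add: rr min_absorb2)
    then show "H M \<subseteq> H N" unfolding H_def using rc by (metis image_eqI image_subsetI)
  qed
  moreover have "carrier F0 \<subseteq> (\<Union>N. H N)"
  proof
    fix x assume x: "x \<in> carrier F0"
    let ?T = "{(j, p, n). prime p \<and> x j p n \<noteq> 0}"
    let ?m = "\<lambda>(j, p, n). max j (max p n)"
    have "finite (?m ` ?T)" using F0_finite_support[OF x] by (rule finite_imageI)
    then obtain N where N: "\<forall>k\<in>?m ` ?T. k < N"
      unfolding finite_nat_set_iff_bounded by (elim exE)
    have *: "j < N \<and> p < N \<and> n < N" if "prime p" "x j p n \<noteq> 0" for j p n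
    proof -
      have "(j, p, n) \<in> ?T" using that by simp
      then have "?m (j, p, n) < N" by (rule bspec[OF N imageI])
      then show ?thesis by simp
    qed
    have "r N x = x"
    proof (intro ext)
      fix j p n show "r N x j p n = x j p n"
        using *[of p j n] x unfolding r_def carrier_F0_iff by (cases "prime p") auto
    qed
    then have "x \<in> H N" unfolding H_def using x by (metis imageI)
    then show "x \<in> (\<Union>N. H N)" by blast
  qed
  moreover have "(\<Union>N. H N) \<subseteq> carrier F0" unfolding H_def using rc by blast
  ultimately show ?thesis
    unfolding union_of_finite_pure_chain_def using pure fin by (intro exI[of _ H]) auto
qed

lemma pure_correspondence_Id_on:
  assumes "pure_subgroup A G"
  shows "pure_correspondence G G (Id_on A)"
  unfolding pure_correspondence_def
  using assms subgroup.m_closed[OF pure_subgroupD(1)[OF assms]] by (auto simp: single_valued_def)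

text \<open>The inductive extension reaches all of \<open>C\<close>; composing with the identity on
  \<open>A\<close> then restricts the result to \<open>A\<close>.\<close>

lemma extends_finite_pure_F0:
  assumes C: "comm_group C" and fin: "finite (carrier C)"
  shows "extends_finite_pure C F0"
  unfolding extends_finite_pure_def
proof (intro allI impI, elim conjE)
  fix A R
  assume A: "pure_subgroup A C" and R: "pure_correspondence C F0 R" and sub: "Domain R \<subseteq> A"
  obtain T where T: "R \<subseteq> T" "pure_correspondence C F0 T" "Domain T = carrier C"
    using extend_to_finite_group[OF C comm_group_F0 fin F0_pure_cyclic_over R] by metis
  note grC = comm_group.axioms(2)[OF C]
  have "Range (Id_on A) \<subseteq> Domain T" using pure_subgroup_subset[OF A] T(3) by auto
  then have "pure_correspondence C F0 (Id_on A O T)"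
    using pure_correspondence_comp[OF grC grC group_F0 pure_correspondence_Id_on[OF A] T(2)] by simp
  moreover have "R \<subseteq> Id_on A O T"
  proof (rule subrelI)
    fix x y assume "(x, y) \<in> R"
    then have "(x, x) \<in> Id_on A" "(x, y) \<in> T" using T(1) sub by blast+
    then show "(x, y) \<in> Id_on A O T" by (rule relcompI)
  qed
  moreover have "Domain (Id_on A O T) = A" using pure_subgroup_subset[OF A] T(3) by blast
  ultimately show "\<exists>R'. R \<subseteq> R' \<and> pure_correspondence C F0 R' \<and> Domain R' = A"
    by (intro exI[of _ "Id_on A O T"]) simp
qed

section \<open>The Fraisse class\<close>

lemma closed_under_pure_subgroups_finite_abelian_groups:
  "closed_under_pure_subgroups finite_abelian_groups"
  unfolding closed_under_pure_subgroups_def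
proof (intro ballI allI impI)
  fix G :: "'u monoid" and H
  assume G: "G \<in> finite_abelian_groups" and H: "pure_subgroup H G"
  then have "comm_group (G\<lparr>carrier := H\<rparr>)"
    unfolding finite_abelian_groups_def
    by (simp add: comm_group.comm_group_subgroup pure_subgroupD(1))
  then show "G\<lparr>carrier := H\<rparr> \<in> finite_abelian_groups"
    using G pure_subgroup_subset[OF H] unfolding finite_abelian_groups_def
    by (auto intro: finite_subset)
qed

text \<open>Amalgamate over the trivial group, which is pure in both groups.\<close>

lemma joint_embedding_from_amalgamation:
  assumes "amalgamation_property (finite_abelian_groups :: 'u monoid set)"
  shows "joint_embedding_property (finite_abelian_groups :: 'u monoid set)"
  unfolding joint_embedding_property_def
proof (intro ballI)
  fix a b :: "'u monoid"
  assume a: "a \<in> finite_abelian_groups" and b: "b \<in> finite_abelian_groups"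
  interpret a: comm_group a using a by (simp add: finite_abelian_groups_def)
  interpret b: comm_group b using b by (simp add: finite_abelian_groups_def)
  let ?t = "a\<lparr>carrier := {\<one>\<^bsub>a\<^esub>}\<rparr>"
  have "?t \<in> finite_abelian_groups"
    using closed_under_pure_subgroups_finite_abelian_groups a a.pure_subgroup_trivial
    unfolding closed_under_pure_subgroups_def by blast
  moreover have "pure_embedding ?t a (\<lambda>x. x)" "pure_embedding ?t b (\<lambda>x. \<one>\<^bsub>b\<^esub>)"
    unfolding pure_embedding_def mon_def hom_def
    using a.pure_subgroup_trivial b.pure_subgroup_trivial by auto
  ultimately obtain d :: "'u monoid" and f g where
    "d \<in> finite_abelian_groups" "pure_embedding a d f" "pure_embedding b d g"
    using assms a b unfolding amalgamation_property_def by meson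
  then show "\<exists>c\<in>finite_abelian_groups :: 'u monoid set. (\<exists>f. pure_embedding a c f) \<and> (\<exists>g. pure_embedding b c g)"
    by (intro bexI[of _ d] conjI exI)
qed

theorem mainTheorem2:
  assumes "infinite (UNIV :: 'u set)"
  shows "fraisse_class_omega (finite_abelian_groups :: 'u monoid set) \<and>
    (comm_group F0 \<and>
     pure_injective_for F0 (finite_abelian_groups :: 'u monoid set) \<and>
     union_of_finite_pure_chain F0) \<and>
    (\<forall>G :: ('a, 'm) monoid_scheme.
       comm_group G \<and>
       pure_injective_for G (finite_abelian_groups :: 'u monoid set) \<and>
       union_of_finite_pure_chain G \<longrightarrow> G \<cong> F0)"
proof -
  have ext: "extends_finite_pure C F0" if "C \<in> finite_abelian_groups" for C :: "'u monoid"
    using that extends_finite_pure_F0 unfolding finite_abelian_groups_def by blast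
  have inj: "pure_injective_for F0 (finite_abelian_groups :: 'u monoid set)"
    using comm_group_F0 ext by (rule pure_injective_if_extends)
  have am: "amalgamation_property (finite_abelian_groups :: 'u monoid set)"
    using comm_group_F0 union_of_finite_pure_chain_F0 assms ext by (rule amalgamation_from_extension)
  have "fraisse_class_omega (finite_abelian_groups :: 'u monoid set)"
    unfolding fraisse_class_omega_def
    using am joint_embedding_from_amalgamation[OF am]
      closed_under_pure_subgroups_finite_abelian_groups
    by (simp add: finite_abelian_groups_def)
  \<comment> \<open>The two directions of the back and forth come from the two pure-injectivities:
    that of \<open>F0\<close> extends from \<open>G\<close> to \<open>F0\<close>, that of
    \<open>G\<close> from \<open>F0\<close> to \<open>G\<close>.\<close>
  moreover have "G \<cong> F0"
    if G: "comm_group G" "pure_injective_for G (finite_abelian_groups :: 'u monoid set)"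
      "union_of_finite_pure_chain G" for G :: "('a, 'm) monoid_scheme"
    by (rule back_and_forth[OF G(1) comm_group_F0
          extends_if_pure_injective[OF G(1) comm_group_F0 assms inj]
          extends_if_pure_injective[OF comm_group_F0 G(1) assms G(2)]
          G(3) union_of_finite_pure_chain_F0])
  ultimately show ?thesis
    using comm_group_F0 inj union_of_finite_pure_chain_F0 by blast
qed

end
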